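(* Let $\Omega$ be a semigroup with unit $1$, let $(A,\{\cdot_{\alpha,\beta}\}_{\alpha,\beta\in\Omega},\{N_\omega\}_{\omega\in\Omega})$ be a Nijenhuis family $\Omega$-associative algebra and $(M,\{N_{M,\omega}\}_{\omega\in\Omega})$ a Nijenhuis family bimodule over it. If two $2$-cocycles $(\{\psi^1_{\alpha,\beta}\},\{\chi^1_\omega\})$ and $(\{\psi^2_{\alpha,\beta}\},\{\chi^2_\omega\})$ of $A$ with coefficients in $M$ are cohomologous, i.e. represent the same class in $\mathrm{H}^2_{\mathrm{NFA}}(A,M)$, then the abelian extensions $(A\oplus M,\{\cdot^{\psi^1}_{\alpha,\beta}\},\{N^{\chi^1}_\omega\})$ and $(A\oplus M,\{\cdot^{\psi^2}_{\alpha,\beta}\},\{N^{\chi^2}_\omega\})$ of $(A,\{N_\omega\})$ by $(M,\{N_{M,\omega}\})$ to which they give rise are isomorphic. Here $$(a,m)\cdot^\psi_{\alpha,\beta}(b,n):=(a\cdot_{\alpha,\beta}b,\ a\cdot_{\alpha,\beta}n+m\cdot_{\alpha,\beta}b+\psi_{\alpha,\beta}(a,b)),\qquad N^\chi_\omega(a,m):=(N_\omega(a),\ \chi_\omega(a)+N_{M,\omega}(m)).$$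
   Context: All vector spaces are over a field $\mathbf{k}$. An $\Omega$-associative algebra is a vector space $A$ with bilinear operations $\cdot_{\alpha,\beta}:A\otimes A\to A$ ($\alpha,\beta\in\Omega$) such that $(a\cdot_{\alpha,\beta}b)\cdot_{\alpha\beta,\gamma}c=a\cdot_{\alpha,\beta\gamma}(b\cdot_{\beta,\gamma}c)$. A Nijenhuis family $\Omega$-associative algebra is an $\Omega$-associative algebra with linear maps $N_\omega:A\to A$ such that $N_\alpha(a)\cdot_{\alpha,\beta}N_\beta(b)=N_{\alpha\beta}\big(N_\alpha(a)\cdot_{\alpha,\beta}b+a\cdot_{\alpha,\beta}N_\beta(b)-N_{\alpha\beta}(a\cdot_{\alpha,\beta}b)\big)$. A morphism is a family of linear maps $f_\omega:A\to A'$ with $f_\omega\circ N_\omega=N'_\omega\circ f_\omega$ and $f_{\alpha\beta}(a\cdot_{\alpha,\beta}b)=f_\alpha(a)\cdot'_{\alpha,\beta}f_\beta(b)$; it is an isomorphism if every $f_\omega$ is bijective. A Nijenhuis family bimodule over $A$ is a vector space $M$ with bilinear maps $\cdot_{\alpha,\beta}:A\otimes M\to M$, $\cdot_{\alpha,\beta}:M\otimes A\to M$ and linear maps $N_{M,\omega}:M\to M$ such that $(a\cdot_{\alpha,\beta}b)\cdot_{\alpha\beta,\gamma}m=a\cdot_{\alpha,\beta\gamma}(b\cdot_{\beta,\gamma}m)$, $(a\cdot_{\alpha,\beta}m)\cdot_{\alpha\beta,\gamma}b=a\cdot_{\alpha,\beta\gamma}(m\cdot_{\beta,\gamma}b)$,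 $(m\cdot_{\alpha,\beta}a)\cdot_{\alpha\beta,\gamma}b=m\cdot_{\alpha,\beta\gamma}(a\cdot_{\beta,\gamma}b)$, $N_\alpha(a)\cdot_{\alpha,\beta}N_{M,\beta}(m)=N_{M,\alpha\beta}\big(a\cdot_{\alpha,\beta}N_{M,\beta}(m)+N_\alpha(a)\cdot_{\alpha,\beta}m-N_{M,\alpha\beta}(a\cdot_{\alpha,\beta}m)\big)$ and $N_{M,\alpha}(m)\cdot_{\alpha,\beta}N_\beta(a)=N_{M,\alpha\beta}\big(m\cdot_{\alpha,\beta}N_\beta(a)+N_{M,\alpha}(m)\cdot_{\alpha,\beta}a-N_{M,\alpha\beta}(m\cdot_{\alpha,\beta}a)\big)$. An abelian extension of $(A,\{N_\omega\})$ by $(M,\{N_{M,\omega}\})$ ($M$ with zero product) is a Nijenhuis family $\Omega$-associative algebra $(\hat A,\{\hat N_\omega\})$ with morphisms $\{i_\omega:M\to\hat A\}$, $\{p_\omega:\hat A\to A\}$ of Nijenhuis family $\Omega$-associative algebras such that $0\to M\xrightarrow{i_\omega}\hat A\xrightarrow{p_\omega}A\to0$ is exact for each $\omega$. For $\hat A=A\oplus M$, $i_\omega(m)=(0,m)$ and $p_\omega(a,m)=a$. Two abelian extensions $(\hat A_1,i^1,p^1)$, $(\hat A_2,i^2,p^2)$ are isomorphic if there is an isomorphism of Nijenhuis family $\Omega$-associative algebras $\{\zeta_\omega\}:\hat A_1\to\hat A_2$ with $\zeta_\omega\circ i^1_\omega=i^2_\omega$ and $p^2_\omega\circ\zeta_\omega=p^1_\omega$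 for all $\omega$. Cohomology: $\mathrm{H}^2_{\mathrm{NFA}}(A,M)=\ker d^2/\operatorname{im}d^1$; $2$-cocycles are the elements of $\ker d^2$. Here $C^1_{\mathrm{NFA}}(A,M)$ consists of pairs $(f,m)$ with $f=\{f_\alpha\}$ a family of linear maps $A\to M$ and $m\in M$; $C^2_{\mathrm{NFA}}(A,M)$ consists of pairs $(f,g)$ with $f=\{f_{\alpha,\beta}\}$ a family of linear maps $A^{\otimes2}\to M$ and $g=\{g_\alpha\}$ a family of linear maps $A\to M$; $d^1(f,m)=(\delta^1(f),-\partial^0(m)-\Phi^1(f))$ and $d^2(f,g)=(\delta^2(f),-\partial^1(g)-\Phi^2(f))$, where $\delta^1(f)_{\alpha,\beta}(a,b)=a\cdot_{\alpha,\beta}f_\beta(b)-f_{\alpha\beta}(a\cdot_{\alpha,\beta}b)+f_\alpha(a)\cdot_{\alpha,\beta}b$; $\delta^2(f)_{\alpha,\beta,\gamma}(a,b,c)=-a\cdot_{\alpha,\beta\gamma}f_{\beta,\gamma}(b,c)+f_{\alpha\beta,\gamma}(a\cdot_{\alpha,\beta}b,c)-f_{\alpha,\beta\gamma}(a,b\cdot_{\beta,\gamma}c)+f_{\alpha,\beta}(a,b)\cdot_{\alpha\beta,\gamma}c$; $\partial^0(m)_\alpha(a)=N_\alpha(a)\cdot_{\alpha,1}m-m\cdot_{1,\alpha}N_\alpha(a)-N_{M,\alpha}(a\cdot_{\alpha,1}m-m\cdot_{1,\alpha}a)$; $\partial^1(g)_{\alpha,\beta}(a,b)=N_\alpha(a)\cdot_{\alpha,\beta}g_\beta(b)-N_{M,\alpha\beta}(a\cdot_{\alpha,\beta}g_\beta(b))-g_{\alpha\beta}\big(N_\alpha(a)\cdot_{\alpha,\beta}b+a\cdot_{\alpha,\beta}N_\beta(b)-N_{\alpha\beta}(a\cdot_{\alpha,\beta}b)\big)+g_\alpha(a)\cdot_{\alpha,\beta}N_\beta(b)-N_{M,\alpha\beta}(g_\alpha(a)\cdot_{\alpha,\beta}b)$;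 $\Phi^1(f)_\alpha(a)=f_\alpha(N_\alpha(a))-N_{M,\alpha}(f_\alpha(a))$; $\Phi^2(f)_{\alpha,\beta}(a,b)=f_{\alpha,\beta}(N_\alpha(a),N_\beta(b))-N_{M,\alpha\beta}f_{\alpha,\beta}(N_\alpha(a),b)-N_{M,\alpha\beta}f_{\alpha,\beta}(a,N_\beta(b))+N_{M,\alpha\beta}^2f_{\alpha,\beta}(a,b)$.
   Formalization: The printed ∂¹ lacks +N_{M,αβ}(g_{αβ}(a·b)); with it, cocycles need not give abelian extensions and d²d¹≠0. For the printed ∂¹ only the isomorphism is proved (classes via differences in im d¹); for the corrected ∂¹, also that both are abelian extensions. *)

theory Defs
  imports Complex_Main "HOL-Library.Product_Plus" "HOL-Library.Function_Algebras"
begin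

text \<open>
  A vector space is a type \<open>'a::ab_group_add\<close> together with a scalar multiplication satisfying
  \<^locale>\<open>vector_space\<close>; this requirement is part of \<^const>\<open>Vector_Spaces.linear\<close>.
  Linear maps out of a tensor product are given by bilinear maps.
\<close>

definition bilinear_map ::
  "('k::field \<Rightarrow> 'a::ab_group_add \<Rightarrow> 'a) \<Rightarrow> ('k \<Rightarrow> 'b::ab_group_add \<Rightarrow> 'b) \<Rightarrow>
   ('k \<Rightarrow> 'c::ab_group_add \<Rightarrow> 'c) \<Rightarrow> ('a \<Rightarrow> 'b \<Rightarrow> 'c) \<Rightarrow> bool" where
  "bilinear_map s1 s2 s3 f \<longleftrightarrow>
     (\<forall>x. Vector_Spaces.linear s2 s3 (\<lambda>y. f x y)) \<and>
     (\<forall>y. Vector_Spaces.linear s1 s3 (\<lambda>x. f x y))"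


section \<open>Nijenhuis family algebras and bimodules\<close>

record ('w, 'k, 'a) nfa =
  scl :: "'k \<Rightarrow> 'a \<Rightarrow> 'a"
  mul :: "'w \<Rightarrow> 'w \<Rightarrow> 'a \<Rightarrow> 'a \<Rightarrow> 'a"
  nij :: "'w \<Rightarrow> 'a \<Rightarrow> 'a"

definition omega_associative_algebra ::
  "('w::semigroup_mult, 'k::field, 'a::ab_group_add) nfa \<Rightarrow> bool" where
  "omega_associative_algebra A \<longleftrightarrow>
     vector_space (scl A) \<and>
     (\<forall>\<alpha> \<beta>. bilinear_map (scl A) (scl A) (scl A) (mul A \<alpha> \<beta>)) \<and>
     (\<forall>\<alpha> \<beta> \<gamma> a b c.
        mul A (\<alpha> * \<beta>) \<gamma> (mul A \<alpha> \<beta> a b) c = mul A \<alpha> (\<beta> * \<gamma>) a (mul A \<beta> \<gamma> b c))"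

definition nijenhuis_family_algebra ::
  "('w::semigroup_mult, 'k::field, 'a::ab_group_add) nfa \<Rightarrow> bool" where
  "nijenhuis_family_algebra A \<longleftrightarrow>
     omega_associative_algebra A \<and>
     (\<forall>\<omega>. Vector_Spaces.linear (scl A) (scl A) (nij A \<omega>)) \<and>
     (\<forall>\<alpha> \<beta> a b.
        mul A \<alpha> \<beta> (nij A \<alpha> a) (nij A \<beta> b) =
        nij A (\<alpha> * \<beta>)
          (mul A \<alpha> \<beta> (nij A \<alpha> a) b + mul A \<alpha> \<beta> a (nij A \<beta> b) - nij A (\<alpha> * \<beta>) (mul A \<alpha> \<beta> a b)))"

text \<open>
  The conditions on maps only; that source and target are Nijenhuis family algebras is stated
  separately.
\<close>

definition nfa_morphism ::
  "('w::semigroup_mult, 'k::field, 'a::ab_group_add) nfa \<Rightarrow> ('w, 'k, 'b::ab_group_add) nfa \<Rightarrow>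
   ('w \<Rightarrow> 'a \<Rightarrow> 'b) \<Rightarrow> bool" where
  "nfa_morphism A B f \<longleftrightarrow>
     (\<forall>\<omega>. Vector_Spaces.linear (scl A) (scl B) (f \<omega>)) \<and>
     (\<forall>\<omega>. f \<omega> \<circ> nij A \<omega> = nij B \<omega> \<circ> f \<omega>) \<and>
     (\<forall>\<alpha> \<beta> a b. f (\<alpha> * \<beta>) (mul A \<alpha> \<beta> a b) = mul B \<alpha> \<beta> (f \<alpha> a) (f \<beta> b))"

definition nfa_isomorphism ::
  "('w::semigroup_mult, 'k::field, 'a::ab_group_add) nfa \<Rightarrow> ('w, 'k, 'b::ab_group_add) nfa \<Rightarrow>
   ('w \<Rightarrow> 'a \<Rightarrow> 'b) \<Rightarrow> bool" where
  "nfa_isomorphism A B f \<longleftrightarrow> nfa_morphism A B f \<and> (\<forall>\<omega>. bij (f \<omega>))"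

record ('w, 'k, 'a, 'm) nfbimod =
  mscl :: "'k \<Rightarrow> 'm \<Rightarrow> 'm"
  lact :: "'w \<Rightarrow> 'w \<Rightarrow> 'a \<Rightarrow> 'm \<Rightarrow> 'm"
  ract :: "'w \<Rightarrow> 'w \<Rightarrow> 'm \<Rightarrow> 'a \<Rightarrow> 'm"
  mnij :: "'w \<Rightarrow> 'm \<Rightarrow> 'm"

definition nijenhuis_family_bimodule ::
  "('w::semigroup_mult, 'k::field, 'a::ab_group_add) nfa \<Rightarrow>
   ('w, 'k, 'a, 'm::ab_group_add) nfbimod \<Rightarrow> bool" where
  "nijenhuis_family_bimodule A M \<longleftrightarrow>
     vector_space (mscl M) \<and>
     (\<forall>\<alpha> \<beta>. bilinear_map (scl A) (mscl M) (mscl M) (lact M \<alpha> \<beta>)) \<and>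
     (\<forall>\<alpha> \<beta>. bilinear_map (mscl M) (scl A) (mscl M) (ract M \<alpha> \<beta>)) \<and>
     (\<forall>\<omega>. Vector_Spaces.linear (mscl M) (mscl M) (mnij M \<omega>)) \<and>
     (\<forall>\<alpha> \<beta> \<gamma> a b m.
        lact M (\<alpha> * \<beta>) \<gamma> (mul A \<alpha> \<beta> a b) m = lact M \<alpha> (\<beta> * \<gamma>) a (lact M \<beta> \<gamma> b m)) \<and>
     (\<forall>\<alpha> \<beta> \<gamma> a m b.
        ract M (\<alpha> * \<beta>) \<gamma> (lact M \<alpha> \<beta> a m) b = lact M \<alpha> (\<beta> * \<gamma>) a (ract M \<beta> \<gamma> m b)) \<and>
     (\<forall>\<alpha> \<beta> \<gamma> m a b.
        ract M (\<alpha> * \<beta>) \<gamma> (ract M \<alpha> \<beta> m a) b = ract M \<alpha> (\<beta> * \<gamma>) m (mul A \<beta> \<gamma> a b)) \<and>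
     (\<forall>\<alpha> \<beta> a m.
        lact M \<alpha> \<beta> (nij A \<alpha> a) (mnij M \<beta> m) =
        mnij M (\<alpha> * \<beta>)
          (lact M \<alpha> \<beta> a (mnij M \<beta> m) + lact M \<alpha> \<beta> (nij A \<alpha> a) m
             - mnij M (\<alpha> * \<beta>) (lact M \<alpha> \<beta> a m))) \<and>
     (\<forall>\<alpha> \<beta> m a.
        ract M \<alpha> \<beta> (mnij M \<alpha> m) (nij A \<beta> a) =
        mnij M (\<alpha> * \<beta>)
          (ract M \<alpha> \<beta> m (nij A \<beta> a) + ract M \<alpha> \<beta> (mnij M \<alpha> m) a
             - mnij M (\<alpha> * \<beta>) (ract M \<alpha> \<beta> m a)))"


section \<open>Abelian extensions\<close>

definition zero_product_nfa ::
  "('w, 'k, 'a, 'm::ab_group_add) nfbimod \<Rightarrow> ('w, 'k, 'm) nfa" where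
  "zero_product_nfa M = \<lparr>scl = mscl M, mul = (\<lambda>\<alpha> \<beta> m n. 0), nij = mnij M\<rparr>"

definition abelian_extension ::
  "('w::semigroup_mult, 'k::field, 'a::ab_group_add) nfa \<Rightarrow>
   ('w, 'k, 'a, 'm::ab_group_add) nfbimod \<Rightarrow> ('w, 'k, 'e::ab_group_add) nfa \<Rightarrow>
   ('w \<Rightarrow> 'm \<Rightarrow> 'e) \<Rightarrow> ('w \<Rightarrow> 'e \<Rightarrow> 'a) \<Rightarrow> bool" where
  "abelian_extension A M E i p \<longleftrightarrow>
     nijenhuis_family_algebra E \<and>
     nfa_morphism (zero_product_nfa M) E i \<and>
     nfa_morphism E A p \<and>
     (\<forall>\<omega>. inj (i \<omega>) \<and> range (i \<omega>) = {x. p \<omega> x = 0} \<and> surj (p \<omega>))"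

definition isomorphic_extensions ::
  "('w::semigroup_mult, 'k::field, 'e::ab_group_add) nfa \<Rightarrow> ('w \<Rightarrow> 'm \<Rightarrow> 'e) \<Rightarrow> ('w \<Rightarrow> 'e \<Rightarrow> 'a) \<Rightarrow>
   ('w, 'k, 'f::ab_group_add) nfa \<Rightarrow> ('w \<Rightarrow> 'm \<Rightarrow> 'f) \<Rightarrow> ('w \<Rightarrow> 'f \<Rightarrow> 'a) \<Rightarrow> bool" where
  "isomorphic_extensions E1 i1 p1 E2 i2 p2 \<longleftrightarrow>
     (\<exists>\<zeta>. nfa_isomorphism E1 E2 \<zeta> \<and>
          (\<forall>\<omega>. \<zeta> \<omega> \<circ> i1 \<omega> = i2 \<omega>) \<and>
          (\<forall>\<omega>. p2 \<omega> \<circ> \<zeta> \<omega> = p1 \<omega>))"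

definition ext_nfa ::
  "('w, 'k, 'a) nfa \<Rightarrow> ('w, 'k, 'a, 'm::ab_group_add) nfbimod \<Rightarrow>
   ('w \<Rightarrow> 'w \<Rightarrow> 'a \<Rightarrow> 'a \<Rightarrow> 'm) \<Rightarrow> ('w \<Rightarrow> 'a \<Rightarrow> 'm) \<Rightarrow> ('w, 'k, 'a \<times> 'm) nfa" where
  "ext_nfa A M \<psi> \<chi> =
     \<lparr>scl = (\<lambda>c (a, m). (scl A c a, mscl M c m)),
      mul = (\<lambda>\<alpha> \<beta> (a, m) (b, n).
               (mul A \<alpha> \<beta> a b, lact M \<alpha> \<beta> a n + ract M \<alpha> \<beta> m b + \<psi> \<alpha> \<beta> a b)),
      nij = (\<lambda>\<omega> (a, m). (nij A \<omega> a, \<chi> \<omega> a + mnij M \<omega> m))\<rparr>"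

definition ext_inj :: "'w \<Rightarrow> 'm \<Rightarrow> 'a::zero \<times> 'm" where
  "ext_inj \<omega> m = (0, m)"

definition ext_proj :: "'w \<Rightarrow> 'a \<times> 'm \<Rightarrow> 'a" where
  "ext_proj \<omega> x = fst x"


section \<open>Cohomology\<close>

type_synonym ('w, 'a, 'm) cochain1 = "('w \<Rightarrow> 'a \<Rightarrow> 'm) \<times> 'm"
type_synonym ('w, 'a, 'm) cochain2 = "('w \<Rightarrow> 'w \<Rightarrow> 'a \<Rightarrow> 'a \<Rightarrow> 'm) \<times> ('w \<Rightarrow> 'a \<Rightarrow> 'm)"
type_synonym ('w, 'a, 'm) cochain3 =
  "('w \<Rightarrow> 'w \<Rightarrow> 'w \<Rightarrow> 'a \<Rightarrow> 'a \<Rightarrow> 'a \<Rightarrow> 'm) \<times> ('w \<Rightarrow> 'w \<Rightarrow> 'a \<Rightarrow> 'a \<Rightarrow> 'm)"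

definition C1_NFA ::
  "('w, 'k::field, 'a::ab_group_add) nfa \<Rightarrow> ('w, 'k, 'a, 'm::ab_group_add) nfbimod \<Rightarrow>
   ('w, 'a, 'm) cochain1 set" where
  "C1_NFA A M = {(f, m). \<forall>\<alpha>. Vector_Spaces.linear (scl A) (mscl M) (f \<alpha>)}"

definition C2_NFA ::
  "('w, 'k::field, 'a::ab_group_add) nfa \<Rightarrow> ('w, 'k, 'a, 'm::ab_group_add) nfbimod \<Rightarrow>
   ('w, 'a, 'm) cochain2 set" where
  "C2_NFA A M = {(f, g). (\<forall>\<alpha> \<beta>. bilinear_map (scl A) (scl A) (mscl M) (f \<alpha> \<beta>)) \<and>
                          (\<forall>\<alpha>. Vector_Spaces.linear (scl A) (mscl M) (g \<alpha>))}"

definition delta1 ::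
  "('w::semigroup_mult, 'k, 'a) nfa \<Rightarrow> ('w, 'k, 'a, 'm::ab_group_add) nfbimod \<Rightarrow>
   ('w \<Rightarrow> 'a \<Rightarrow> 'm) \<Rightarrow> 'w \<Rightarrow> 'w \<Rightarrow> 'a \<Rightarrow> 'a \<Rightarrow> 'm" where
  "delta1 A M f \<alpha> \<beta> a b =
     lact M \<alpha> \<beta> a (f \<beta> b) - f (\<alpha> * \<beta>) (mul A \<alpha> \<beta> a b) + ract M \<alpha> \<beta> (f \<alpha> a) b"

definition delta2 ::
  "('w::semigroup_mult, 'k, 'a) nfa \<Rightarrow> ('w, 'k, 'a, 'm::ab_group_add) nfbimod \<Rightarrow>
   ('w \<Rightarrow> 'w \<Rightarrow> 'a \<Rightarrow> 'a \<Rightarrow> 'm) \<Rightarrow> 'w \<Rightarrow> 'w \<Rightarrow> 'w \<Rightarrow> 'a \<Rightarrow> 'a \<Rightarrow> 'a \<Rightarrow> 'm" where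
  "delta2 A M f \<alpha> \<beta> \<gamma> a b c =
     - lact M \<alpha> (\<beta> * \<gamma>) a (f \<beta> \<gamma> b c) + f (\<alpha> * \<beta>) \<gamma> (mul A \<alpha> \<beta> a b) c
     - f \<alpha> (\<beta> * \<gamma>) a (mul A \<beta> \<gamma> b c) + ract M (\<alpha> * \<beta>) \<gamma> (f \<alpha> \<beta> a b) c"

definition partial0 ::
  "('w::monoid_mult, 'k, 'a) nfa \<Rightarrow> ('w, 'k, 'a, 'm::ab_group_add) nfbimod \<Rightarrow>
   'm \<Rightarrow> 'w \<Rightarrow> 'a \<Rightarrow> 'm" where
  "partial0 A M m \<alpha> a =
     lact M \<alpha> 1 (nij A \<alpha> a) m - ract M 1 \<alpha> m (nij A \<alpha> a)
     - mnij M \<alpha> (lact M \<alpha> 1 a m - ract M 1 \<alpha> m a)"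

definition partial1 ::
  "('w::semigroup_mult, 'k, 'a::ab_group_add) nfa \<Rightarrow>
   ('w, 'k, 'a, 'm::ab_group_add) nfbimod \<Rightarrow> ('w \<Rightarrow> 'a \<Rightarrow> 'm) \<Rightarrow> 'w \<Rightarrow> 'w \<Rightarrow> 'a \<Rightarrow> 'a \<Rightarrow> 'm" where
  "partial1 A M g \<alpha> \<beta> a b =
     lact M \<alpha> \<beta> (nij A \<alpha> a) (g \<beta> b) - mnij M (\<alpha> * \<beta>) (lact M \<alpha> \<beta> a (g \<beta> b))
     - g (\<alpha> * \<beta>)
         (mul A \<alpha> \<beta> (nij A \<alpha> a) b + mul A \<alpha> \<beta> a (nij A \<beta> b) - nij A (\<alpha> * \<beta>) (mul A \<alpha> \<beta> a b))
     + ract M \<alpha> \<beta> (g \<alpha> a) (nij A \<beta> b) - mnij M (\<alpha> * \<beta>) (ract M \<alpha> \<beta> (g \<alpha> a) b)"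

text \<open>
  \<^const>\<open>partial1\<close> is the formula as printed in the paper. With it \<open>d\<^sup>2 \<circ> d\<^sup>1 = 0\<close> fails, and
  a cocycle need not make \<open>A \<oplus> M\<close> a Nijenhuis family algebra (take \<open>\<Omega> = {1}\<close>, \<open>A = M = k\<close>,
  \<open>N = 0\<close>, \<open>N\<^sub>M = id\<close>, both actions zero, \<open>\<psi> = 0\<close>, \<open>\<chi> = id\<close>). Once the term
  \<open>N\<^sub>M (g (a \<cdot> b))\<close> is added, as in the following variant, neither problem remains. The differential \<open>d\<^sup>2\<close> and
  everything depending on it take the operator \<open>\<partial>\<^sup>1\<close> as the parameter \<open>D\<close>.
\<close>

definition partial1_corrected ::
  "('w::semigroup_mult, 'k, 'a::ab_group_add) nfa \<Rightarrow>
   ('w, 'k, 'a, 'm::ab_group_add) nfbimod \<Rightarrow> ('w \<Rightarrow> 'a \<Rightarrow> 'm) \<Rightarrow> 'w \<Rightarrow> 'w \<Rightarrow> 'a \<Rightarrow> 'a \<Rightarrow> 'm" where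
  "partial1_corrected A M g \<alpha> \<beta> a b =
     partial1 A M g \<alpha> \<beta> a b + mnij M (\<alpha> * \<beta>) (g (\<alpha> * \<beta>) (mul A \<alpha> \<beta> a b))"

definition Phi1 ::
  "('w, 'k, 'a) nfa \<Rightarrow> ('w, 'k, 'a, 'm::ab_group_add) nfbimod \<Rightarrow>
   ('w \<Rightarrow> 'a \<Rightarrow> 'm) \<Rightarrow> 'w \<Rightarrow> 'a \<Rightarrow> 'm" where
  "Phi1 A M f \<alpha> a = f \<alpha> (nij A \<alpha> a) - mnij M \<alpha> (f \<alpha> a)"

definition Phi2 ::
  "('w::semigroup_mult, 'k, 'a) nfa \<Rightarrow> ('w, 'k, 'a, 'm::ab_group_add) nfbimod \<Rightarrow>
   ('w \<Rightarrow> 'w \<Rightarrow> 'a \<Rightarrow> 'a \<Rightarrow> 'm) \<Rightarrow> 'w \<Rightarrow> 'w \<Rightarrow> 'a \<Rightarrow> 'a \<Rightarrow> 'm" where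
  "Phi2 A M f \<alpha> \<beta> a b =
     f \<alpha> \<beta> (nij A \<alpha> a) (nij A \<beta> b) - mnij M (\<alpha> * \<beta>) (f \<alpha> \<beta> (nij A \<alpha> a) b)
     - mnij M (\<alpha> * \<beta>) (f \<alpha> \<beta> a (nij A \<beta> b))
     + mnij M (\<alpha> * \<beta>) (mnij M (\<alpha> * \<beta>) (f \<alpha> \<beta> a b))"

definition d1_NFA ::
  "('w::monoid_mult, 'k, 'a) nfa \<Rightarrow> ('w, 'k, 'a, 'm::ab_group_add) nfbimod \<Rightarrow>
   ('w, 'a, 'm) cochain1 \<Rightarrow> ('w, 'a, 'm) cochain2" where
  "d1_NFA A M = (\<lambda>(f, m). (delta1 A M f, - partial0 A M m - Phi1 A M f))"

definition d2_NFA ::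
  "(('w \<Rightarrow> 'a \<Rightarrow> 'm) \<Rightarrow> 'w \<Rightarrow> 'w \<Rightarrow> 'a \<Rightarrow> 'a \<Rightarrow> 'm) \<Rightarrow>
   ('w::semigroup_mult, 'k, 'a) nfa \<Rightarrow> ('w, 'k, 'a, 'm::ab_group_add) nfbimod \<Rightarrow>
   ('w, 'a, 'm) cochain2 \<Rightarrow> ('w, 'a, 'm) cochain3" where
  "d2_NFA D A M = (\<lambda>(f, g). (delta2 A M f, - D g - Phi2 A M f))"

definition Z2_NFA ::
  "(('w \<Rightarrow> 'a \<Rightarrow> 'm) \<Rightarrow> 'w \<Rightarrow> 'w \<Rightarrow> 'a \<Rightarrow> 'a \<Rightarrow> 'm) \<Rightarrow>
   ('w::semigroup_mult, 'k::field, 'a::ab_group_add) nfa \<Rightarrow>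
   ('w, 'k, 'a, 'm::ab_group_add) nfbimod \<Rightarrow> ('w, 'a, 'm) cochain2 set" where
  "Z2_NFA D A M = {c \<in> C2_NFA A M. d2_NFA D A M c = 0}"

definition cohomologous ::
  "(('w \<Rightarrow> 'a \<Rightarrow> 'm) \<Rightarrow> 'w \<Rightarrow> 'w \<Rightarrow> 'a \<Rightarrow> 'a \<Rightarrow> 'm) \<Rightarrow>
   ('w::monoid_mult, 'k::field, 'a::ab_group_add) nfa \<Rightarrow>
   ('w, 'k, 'a, 'm::ab_group_add) nfbimod \<Rightarrow>
   (('w, 'a, 'm) cochain2 \<times> ('w, 'a, 'm) cochain2) set" where
  "cohomologous D A M =
     {(c, c'). c \<in> Z2_NFA D A M \<and> c' \<in> Z2_NFA D A M \<and> c - c' \<in> d1_NFA A M ` C1_NFA A M}"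

text \<open>
  The class of a cocycle in \<open>H\<^sup>2\<close>, which is the quotient
  \<open>Z2_NFA D A M // cohomologous D A M\<close>.
\<close>

definition H2_class ::
  "(('w \<Rightarrow> 'a \<Rightarrow> 'm) \<Rightarrow> 'w \<Rightarrow> 'w \<Rightarrow> 'a \<Rightarrow> 'a \<Rightarrow> 'm) \<Rightarrow>
   ('w::monoid_mult, 'k::field, 'a::ab_group_add) nfa \<Rightarrow>
   ('w, 'k, 'a, 'm::ab_group_add) nfbimod \<Rightarrow> ('w, 'a, 'm) cochain2 \<Rightarrow>
   ('w, 'a, 'm) cochain2 set" where
  "H2_class D A M c = cohomologous D A M `` {c}"

end

theory Submission
  imports Defs
begin

text \<open>
  If \<open>(\<psi>\<^sup>1, \<chi>\<^sup>1) - (\<psi>\<^sup>2, \<chi>\<^sup>2) = d\<^sup>1(f, m)\<close>, the isomorphism is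
  \<open>\<zeta>\<^sub>\<omega>(a, x) = (a, x + h\<^sub>\<omega>(a))\<close> with
  \<open>h\<^sub>\<omega>(a) = f\<^sub>\<omega>(a) + a \<cdot>\<^bsub>\<omega>,1\<^esub> m - m \<cdot>\<^bsub>1,\<omega>\<^esub> a\<close>. The inner part of \<open>h\<close> is killed by \<open>\<delta>\<^sup>1\<close>, and
  \<open>\<Phi>\<^sup>1\<close> maps it to \<open>\<partial>\<^sup>0(m)\<close>, so \<open>(\<psi>\<^sup>1, \<chi>\<^sup>1) - (\<psi>\<^sup>2, \<chi>\<^sup>2) = d\<^sup>1(h, 0)\<close>, which says exactly
  that \<open>\<zeta>\<close> is compatible with products and Nijenhuis operators. No cocycle condition enters
  here, so this part holds for either form of \<open>\<partial>\<^sup>1\<close>; only the proof that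
  \<open>A \<oplus> M\<close> is a Nijenhuis family algebra needs the corrected one.
\<close>

section \<open>Bilinear maps and products of vector spaces\<close>

text \<open>Turns bilinearity into equations that serve both as goals and, for the given structure
  maps, as rewrite rules.\<close>

lemma bilinear_map_iff:
  "bilinear_map s1 s2 s3 f \<longleftrightarrow>
     vector_space s1 \<and> vector_space s2 \<and> vector_space s3 \<and>
     (\<forall>x y z. f x (y + z) = f x y + f x z) \<and> (\<forall>x y z. f (x + y) z = f x z + f y z) \<and>
     (\<forall>c x y. f x (s2 c y) = s3 c (f x y)) \<and> (\<forall>c x y. f (s1 c x) y = s3 c (f x y))"
  unfolding bilinear_map_def Vector_Spaces.linear_iff by blast

lemma bilinear_map_diff:
  assumes "bilinear_map s1 s2 s3 f"
  shows "f (x - x') y = f x y - f x' y" and "f x (y - y') = f x y - f x y'"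
proof -
  have "module_hom s1 s3 (\<lambda>x. f x y)" "module_hom s2 s3 (f x)"
    using assms unfolding bilinear_map_def module_hom_iff_linear by blast+
  then show "f (x - x') y = f x y - f x' y" and "f x (y - y') = f x y - f x y'"
    by (auto dest: module_hom.diff)
qed

lemma bilinear_map_zero:
  assumes "bilinear_map s1 s2 s3 f"
  shows "f 0 y = 0" and "f x 0 = 0"
  using bilinear_map_diff(1)[OF assms, of 0 0 y] bilinear_map_diff(2)[OF assms, of x 0 0]
  by simp_all

text \<open>The pattern-matching abstraction is the form that \<open>scl\<close> takes when
  \<open>ext_nfa\<close> is unfolded.\<close>

lemma vector_space_prod:
  assumes "vector_space s1" and "vector_space s2"
  shows "vector_space (\<lambda>c (a, m). (s1 c a, s2 c m))"
  using assms unfolding vector_space_def by (auto simp: plus_prod_def)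

section \<open>Algebra and bimodule axioms as rewrite rules\<close>

locale nijenhuis_bimodule =
  fixes A :: "('w::monoid_mult, 'k::field, 'a::ab_group_add) nfa"
    and M :: "('w, 'k, 'a, 'm::ab_group_add) nfbimod"
  assumes algebra: "nijenhuis_family_algebra A"
    and bimodule: "nijenhuis_family_bimodule A M"
begin

lemma vs [simp]: "vector_space (scl A)" "vector_space (mscl M)"
  using algebra bimodule
  unfolding nijenhuis_family_algebra_def omega_associative_algebra_def
    nijenhuis_family_bimodule_def by auto

lemma bilinear:
  "bilinear_map (scl A) (scl A) (scl A) (mul A \<alpha> \<beta>)"
  "bilinear_map (scl A) (mscl M) (mscl M) (lact M \<alpha> \<beta>)"
  "bilinear_map (mscl M) (scl A) (mscl M) (ract M \<alpha> \<beta>)"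
  using algebra bimodule
  unfolding nijenhuis_family_algebra_def omega_associative_algebra_def
    nijenhuis_family_bimodule_def by auto

lemma linear:
  "Vector_Spaces.linear (scl A) (scl A) (nij A \<omega>)"
  "Vector_Spaces.linear (mscl M) (mscl M) (mnij M \<omega>)"
  using algebra bimodule
  unfolding nijenhuis_family_algebra_def nijenhuis_family_bimodule_def by auto

lemma assoc:
  "mul A (\<alpha> * \<beta>) \<gamma> (mul A \<alpha> \<beta> a b) c = mul A \<alpha> (\<beta> * \<gamma>) a (mul A \<beta> \<gamma> b c)"
  "lact M (\<alpha> * \<beta>) \<gamma> (mul A \<alpha> \<beta> a b) m = lact M \<alpha> (\<beta> * \<gamma>) a (lact M \<beta> \<gamma> b m)"
  "ract M (\<alpha> * \<beta>) \<gamma> (lact M \<alpha> \<beta> a m) b = lact M \<alpha> (\<beta> * \<gamma>) a (ract M \<beta> \<gamma> m b)"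
  "ract M (\<alpha> * \<beta>) \<gamma> (ract M \<alpha> \<beta> m a) b = ract M \<alpha> (\<beta> * \<gamma>) m (mul A \<beta> \<gamma> a b)"
  using algebra bimodule
  unfolding nijenhuis_family_algebra_def omega_associative_algebra_def
    nijenhuis_family_bimodule_def by auto

lemma nijenhuis:
  "mul A \<alpha> \<beta> (nij A \<alpha> a) (nij A \<beta> b) =
     nij A (\<alpha> * \<beta>)
       (mul A \<alpha> \<beta> (nij A \<alpha> a) b + mul A \<alpha> \<beta> a (nij A \<beta> b) - nij A (\<alpha> * \<beta>) (mul A \<alpha> \<beta> a b))"
  "lact M \<alpha> \<beta> (nij A \<alpha> a) (mnij M \<beta> m) =
     mnij M (\<alpha> * \<beta>)
       (lact M \<alpha> \<beta> a (mnij M \<beta> m) + lact M \<alpha> \<beta> (nij A \<alpha> a) m - mnij M (\<alpha> * \<beta>) (lact M \<alpha> \<beta> a m))"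
  "ract M \<alpha> \<beta> (mnij M \<alpha> m) (nij A \<beta> a) =
     mnij M (\<alpha> * \<beta>)
       (ract M \<alpha> \<beta> m (nij A \<beta> a) + ract M \<alpha> \<beta> (mnij M \<alpha> m) a - mnij M (\<alpha> * \<beta>) (ract M \<alpha> \<beta> m a))"
  using algebra bimodule
  unfolding nijenhuis_family_algebra_def nijenhuis_family_bimodule_def by auto

text \<open>With these rules all structure maps are pushed through sums and scalars, so that
  identities in \<open>ext_nfa\<close> become identities in an abelian group.\<close>

lemmas add = bilinear[unfolded bilinear_map_iff] linear[unfolded Vector_Spaces.linear_iff]

lemmas diff = bilinear[THEN bilinear_map_diff(1)] bilinear[THEN bilinear_map_diff(2)]
  linear[folded module_hom_iff_linear, THEN module_hom.diff]

lemmas zero = bilinear[THEN bilinear_map_zero(1)] bilinear[THEN bilinear_map_zero(2)]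

lemmas linear_zero = linear[folded module_hom_iff_linear, THEN module_hom.zero]

lemmas scl_zero = vs(1)[folded module_iff_vector_space, THEN module.scale_zero_right]

lemmas mscl_add = vs(2)[folded module_iff_vector_space, THEN module.scale_right_distrib]

lemmas mscl_diff = vs(2)[folded module_iff_vector_space, THEN module.scale_right_diff_distrib]

lemma vs_ext [simp]: "vector_space (scl (ext_nfa A M \<psi> \<chi>))"
  using vector_space_prod[OF vs] by (simp add: ext_nfa_def)

section \<open>Absorbing inner cochains\<close>

lemma inner_linear:
  "Vector_Spaces.linear (scl A) (mscl M) (\<lambda>a. lact M \<alpha> 1 a m - ract M 1 \<alpha> m a)"
  unfolding Vector_Spaces.linear_iff by (simp add: add mscl_diff)

text \<open>The six terms cancel in pairs by the three bimodule associativity laws, each taken with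
  one index 1; the unit laws then make the indices agree.\<close>

lemma delta1_inner:
  "delta1 A M (\<lambda>\<alpha> a. lact M \<alpha> 1 a m - ract M 1 \<alpha> m a) \<alpha> \<beta> a b = 0"
  using assoc(2)[of \<alpha> \<beta> 1 a b m] assoc(3)[of \<alpha> 1 \<beta> a m b] assoc(4)[of 1 \<alpha> \<beta> m a b]
  by (simp add: delta1_def diff)

lemma Phi1_inner:
  "Phi1 A M (\<lambda>\<alpha> a. lact M \<alpha> 1 a m - ract M 1 \<alpha> m a) = partial0 A M m"
  by (simp add: fun_eq_iff Phi1_def partial0_def)

lemma delta1_add:
  "delta1 A M (\<lambda>\<alpha> a. f \<alpha> a + g \<alpha> a) \<alpha> \<beta> a b = delta1 A M f \<alpha> \<beta> a b + delta1 A M g \<alpha> \<beta> a b"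
  by (simp add: delta1_def add)

lemma Phi1_add:
  "Phi1 A M (\<lambda>\<alpha> a. f \<alpha> a + g \<alpha> a) \<alpha> a = Phi1 A M f \<alpha> a + Phi1 A M g \<alpha> a"
  by (simp add: Phi1_def add)

text \<open>Normalizes a coboundary: the element m of the 1-cochain moves into the family of maps,
  where \<open>Phi1\<close> reproduces the \<open>partial0\<close> term.\<close>

lemma d1_without_inner:
  assumes "c \<in> C1_NFA A M"
  obtains h where "(h, 0) \<in> C1_NFA A M"
    and "d1_NFA A M c = (delta1 A M h, - Phi1 A M h)"
proof -
  obtain f m where c: "c = (f, m)" by (cases c)
  let ?i = "\<lambda>\<alpha> a. lact M \<alpha> 1 a m - ract M 1 \<alpha> m a"
  let ?h = "\<lambda>\<alpha> a. f \<alpha> a + ?i \<alpha> a"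
  have f: "\<And>\<alpha>. Vector_Spaces.linear (scl A) (mscl M) (f \<alpha>)"
    using assms by (simp add: c C1_NFA_def)
  have "(?h, 0) \<in> C1_NFA A M"
    using f inner_linear[of _ m]
    unfolding C1_NFA_def Vector_Spaces.linear_iff by (auto simp: mscl_add)
  moreover have "d1_NFA A M c = (delta1 A M ?h, - Phi1 A M ?h)"
  proof -
    have "delta1 A M ?h \<alpha> \<beta> a b = delta1 A M f \<alpha> \<beta> a b" for \<alpha> \<beta> a b
      using delta1_add[of f ?i] delta1_inner[of m] by simp
    moreover have "Phi1 A M ?h \<alpha> a = Phi1 A M f \<alpha> a + partial0 A M m \<alpha> a" for \<alpha> a
      using Phi1_add[of f ?i] Phi1_inner[of m] by simp
    ultimately show ?thesis
      by (simp add: c d1_NFA_def fun_eq_iff)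
  qed
  ultimately show ?thesis using that by blast
qed

section \<open>From cohomologous cocycles to isomorphic extensions\<close>

lemma cohomologous_refl:
  assumes "c \<in> Z2_NFA D A M"
  shows "(c, c) \<in> cohomologous D A M"
proof -
  \<comment> \<open>Linearity of the zero map is obtained as the case m = 0 of the inner
    maps.\<close>
  have "(0, 0) \<in> C1_NFA A M"
    using inner_linear[of _ 0] by (auto simp: C1_NFA_def zero func_zero)
  moreover have "d1_NFA A M (0, 0) = 0"
    by (simp add: d1_NFA_def zero_prod_def fun_eq_iff delta1_def partial0_def Phi1_def zero
      linear_zero)
  ultimately have "0 \<in> d1_NFA A M ` C1_NFA A M"
    by (metis imageI)
  with assms show ?thesis
    by (simp add: cohomologous_def)
qed

lemma isomorphic_extensions_coboundary:
  assumes "(h, 0) \<in> C1_NFA A M"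
    and \<psi>: "\<psi>1 - \<psi>2 = delta1 A M h"
    and \<chi>: "\<chi>1 - \<chi>2 = - Phi1 A M h"
  shows "isomorphic_extensions
    (ext_nfa A M \<psi>1 \<chi>1) ext_inj ext_proj (ext_nfa A M \<psi>2 \<chi>2) ext_inj ext_proj"
proof -
  define \<zeta> where "\<zeta> \<omega> = (\<lambda>(a, x). (a, x + h \<omega> a))" for \<omega>
  have h: "\<And>\<omega> a b. h \<omega> (a + b) = h \<omega> a + h \<omega> b"
    "\<And>\<omega> c a. h \<omega> (scl A c a) = mscl M c (h \<omega> a)"
    using assms(1) unfolding C1_NFA_def Vector_Spaces.linear_iff by auto
  \<comment> \<open>This makes \<open>\<zeta>\<close> fix every (0, m), hence compatible with
    \<open>ext_inj\<close>.\<close>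
  have h0: "h \<omega> 0 = 0" for \<omega>
    using h(1)[of \<omega> 0 0] by simp
  have \<psi>': "\<psi>1 \<alpha> \<beta> a b = \<psi>2 \<alpha> \<beta> a b + delta1 A M h \<alpha> \<beta> a b" for \<alpha> \<beta> a b
    using \<psi> by (simp add: fun_eq_iff algebra_simps)
  have \<chi>': "\<chi>1 \<omega> a = \<chi>2 \<omega> a - Phi1 A M h \<omega> a" for \<omega> a
    using \<chi> by (simp add: fun_eq_iff algebra_simps)
  have "Vector_Spaces.linear (scl (ext_nfa A M \<psi>1 \<chi>1)) (scl (ext_nfa A M \<psi>2 \<chi>2)) (\<zeta> \<omega>)" for \<omega>
    unfolding Vector_Spaces.linear_iff
    by (auto simp: \<zeta>_def h mscl_add ext_nfa_def vector_space_prod algebra_simps)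
  moreover have "\<zeta> \<omega> \<circ> nij (ext_nfa A M \<psi>1 \<chi>1) \<omega> = nij (ext_nfa A M \<psi>2 \<chi>2) \<omega> \<circ> \<zeta> \<omega>" for \<omega>
    by (auto simp: fun_eq_iff \<zeta>_def ext_nfa_def \<chi>' Phi1_def add algebra_simps)
  moreover have "\<zeta> (\<alpha> * \<beta>) (mul (ext_nfa A M \<psi>1 \<chi>1) \<alpha> \<beta> x y) =
      mul (ext_nfa A M \<psi>2 \<chi>2) \<alpha> \<beta> (\<zeta> \<alpha> x) (\<zeta> \<beta> y)" for \<alpha> \<beta> x y
    by (cases x; cases y) (simp add: \<zeta>_def ext_nfa_def \<psi>' delta1_def add algebra_simps)
  moreover have "bij (\<zeta> \<omega>)" for \<omega>
    by (rule o_bij[where g = "\<lambda>(a, x). (a, x - h \<omega> a)"]) (auto simp: fun_eq_iff \<zeta>_def)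
  moreover have "\<zeta> \<omega> \<circ> ext_inj \<omega> = ext_inj \<omega>" for \<omega>
    by (simp add: fun_eq_iff \<zeta>_def ext_inj_def h0)
  moreover have "ext_proj \<omega> \<circ> \<zeta> \<omega> = ext_proj \<omega>" for \<omega>
    by (auto simp: fun_eq_iff \<zeta>_def ext_proj_def)
  ultimately show ?thesis
    unfolding isomorphic_extensions_def nfa_isomorphism_def nfa_morphism_def by blast
qed

text \<open>Keeping \<open>D\<close> arbitrary lets one argument serve both halves of the
  theorem.\<close>

lemma isomorphic_extensions_H2:
  assumes "(\<psi>2, \<chi>2) \<in> Z2_NFA D A M"
    and "H2_class D A M (\<psi>1, \<chi>1) = H2_class D A M (\<psi>2, \<chi>2)"
  shows "isomorphic_extensions
    (ext_nfa A M \<psi>1 \<chi>1) ext_inj ext_proj (ext_nfa A M \<psi>2 \<chi>2) ext_inj ext_proj"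
proof -
  \<comment> \<open>By reflexivity the second cocycle lies in its own class, hence in the class of
    the first.\<close>
  have "((\<psi>1, \<chi>1), (\<psi>2, \<chi>2)) \<in> cohomologous D A M"
    using cohomologous_refl[OF assms(1)] assms(2) by (auto simp: H2_class_def)
  then obtain c where "c \<in> C1_NFA A M" and c: "(\<psi>1, \<chi>1) - (\<psi>2, \<chi>2) = d1_NFA A M c"
    by (auto simp: cohomologous_def)
  then obtain h where "(h, 0) \<in> C1_NFA A M" "d1_NFA A M c = (delta1 A M h, - Phi1 A M h)"
    by (metis d1_without_inner)
  then show ?thesis
    using isomorphic_extensions_coboundary c by simp
qed

section \<open>From corrected cocycles to abelian extensions\<close>

text \<open>The first components repeat the identities of A. In the second, associativity is the
  bimodule associativity laws plus \<open>delta2 A M \<psi> = 0\<close>, and the Nijenhuis identity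
  is the two bimodule Nijenhuis laws plus the vanishing of
  \<open>partial1_corrected A M \<chi> + Phi2 A M \<psi>\<close>. The correcting term arises when
  the extended operator is applied twice to a product.\<close>

lemma abelian_extension_corrected:
  assumes "(\<psi>, \<chi>) \<in> Z2_NFA (partial1_corrected A M) A M"
  shows "abelian_extension A M (ext_nfa A M \<psi> \<chi>) ext_inj ext_proj"
proof -
  let ?E = "ext_nfa A M \<psi> \<chi>"
  have bilin: "\<And>\<alpha> \<beta>. bilinear_map (scl A) (scl A) (mscl M) (\<psi> \<alpha> \<beta>)"
    and lin: "\<And>\<omega>. Vector_Spaces.linear (scl A) (mscl M) (\<chi> \<omega>)"
    using assms by (auto simp: Z2_NFA_def C2_NFA_def)
  note cochain = bilin[unfolded bilinear_map_iff] lin[unfolded Vector_Spaces.linear_iff]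
  \<comment> \<open>These two zeros make \<open>ext_inj\<close> a morphism: (0, m) and (0, n) have
    product (0, \<open>\<psi> \<alpha> \<beta> 0 0\<close>), and the extended operator sends (0, m)
    to (0, \<open>\<chi> \<omega> 0 + mnij M \<omega> m\<close>).\<close>
  have \<psi>0: "\<psi> \<alpha> \<beta> 0 0 = 0" for \<alpha> \<beta>
    using bilinear_map_zero(1) bilin by blast
  have \<chi>0: "\<chi> \<omega> 0 = 0" for \<omega>
    using module_hom.zero lin module_hom_iff_linear by blast
  have delta2: "delta2 A M \<psi> \<alpha> \<beta> \<gamma> a b c = 0" for \<alpha> \<beta> \<gamma> a b c
    using assms by (simp add: Z2_NFA_def d2_NFA_def zero_prod_def fun_eq_iff)
  \<comment> \<open>Each cocycle equation is solved for the \<open>\<psi>\<close> term that matches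
    the left-hand side of \<open>assoc\<close> or \<open>nijenhuis\<close>, so that simplification
    rewrites all components in the same direction.\<close>
  have assoc_\<psi>: "\<psi> (\<alpha> * \<beta>) \<gamma> (mul A \<alpha> \<beta> a b) c =
      lact M \<alpha> (\<beta> * \<gamma>) a (\<psi> \<beta> \<gamma> b c) + \<psi> \<alpha> (\<beta> * \<gamma>) a (mul A \<beta> \<gamma> b c)
      - ract M (\<alpha> * \<beta>) \<gamma> (\<psi> \<alpha> \<beta> a b) c" for \<alpha> \<beta> \<gamma> a b c
    using delta2[of \<alpha> \<beta> \<gamma> a b c] by (simp add: delta2_def algebra_simps)
  have "- partial1_corrected A M \<chi> \<alpha> \<beta> a b - Phi2 A M \<psi> \<alpha> \<beta> a b = 0" for \<alpha> \<beta> a b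
    using assms by (simp add: Z2_NFA_def d2_NFA_def zero_prod_def fun_eq_iff)
  then have nij_\<psi>: "\<psi> \<alpha> \<beta> (nij A \<alpha> a) (nij A \<beta> b) =
      - partial1_corrected A M \<chi> \<alpha> \<beta> a b + mnij M (\<alpha> * \<beta>) (\<psi> \<alpha> \<beta> (nij A \<alpha> a) b)
      + mnij M (\<alpha> * \<beta>) (\<psi> \<alpha> \<beta> a (nij A \<beta> b))
      - mnij M (\<alpha> * \<beta>) (mnij M (\<alpha> * \<beta>) (\<psi> \<alpha> \<beta> a b))" for \<alpha> \<beta> a b
    by (simp add: Phi2_def algebra_simps)
  have "bilinear_map (scl ?E) (scl ?E) (scl ?E) (mul ?E \<alpha> \<beta>)" for \<alpha> \<beta>
    unfolding bilinear_map_iff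
    by (auto simp: ext_nfa_def vector_space_prod add cochain mscl_add algebra_simps)
  moreover have "mul ?E (\<alpha> * \<beta>) \<gamma> (mul ?E \<alpha> \<beta> x y) z = mul ?E \<alpha> (\<beta> * \<gamma>) x (mul ?E \<beta> \<gamma> y z)"
    for \<alpha> \<beta> \<gamma> x y z
    by (cases x; cases y; cases z) (simp add: ext_nfa_def assoc assoc_\<psi> add algebra_simps)
  moreover have "Vector_Spaces.linear (scl ?E) (scl ?E) (nij ?E \<omega>)" for \<omega>
    unfolding Vector_Spaces.linear_iff
    by (auto simp: ext_nfa_def vector_space_prod add cochain mscl_add algebra_simps)
  moreover have "mul ?E \<alpha> \<beta> (nij ?E \<alpha> x) (nij ?E \<beta> y) =
      nij ?E (\<alpha> * \<beta>)
        (mul ?E \<alpha> \<beta> (nij ?E \<alpha> x) y + mul ?E \<alpha> \<beta> x (nij ?E \<beta> y)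
          - nij ?E (\<alpha> * \<beta>) (mul ?E \<alpha> \<beta> x y))" for \<alpha> \<beta> x y
    by (cases x; cases y)
      (simp add: ext_nfa_def nijenhuis nij_\<psi> partial1_corrected_def partial1_def add diff
        algebra_simps)
  ultimately have "nijenhuis_family_algebra ?E"
    unfolding nijenhuis_family_algebra_def omega_associative_algebra_def using vs_ext by blast
  moreover have "nfa_morphism (zero_product_nfa M) ?E ext_inj"
    unfolding nfa_morphism_def Vector_Spaces.linear_iff
    using vs_ext[of \<psi> \<chi>] vs
    by (auto simp: zero_product_nfa_def ext_inj_def ext_nfa_def fun_eq_iff zero zero_prod_def
      \<psi>0 \<chi>0 linear_zero scl_zero)
  moreover have "nfa_morphism ?E A ext_proj"
    unfolding nfa_morphism_def Vector_Spaces.linear_iff using vs_ext[of \<psi> \<chi>]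
    by (auto simp: ext_nfa_def ext_proj_def fun_eq_iff)
  moreover have "inj (ext_inj \<omega> :: 'm \<Rightarrow> 'a \<times> 'm)"
    and "range (ext_inj \<omega> :: 'm \<Rightarrow> 'a \<times> 'm) = {x. ext_proj \<omega> x = 0}"
    and "surj (ext_proj \<omega> :: 'a \<times> 'm \<Rightarrow> 'a)" for \<omega> :: 'w
    by (auto simp: inj_def surj_def ext_inj_def ext_proj_def)
  ultimately show ?thesis
    unfolding abelian_extension_def by blast
qed

end

theorem proposition5p8:
  fixes A :: "('w::monoid_mult, 'k::field, 'a::ab_group_add) nfa"
    and M :: "('w, 'k, 'a, 'm::ab_group_add) nfbimod"
    and \<psi>1 \<psi>2 :: "'w \<Rightarrow> 'w \<Rightarrow> 'a \<Rightarrow> 'a \<Rightarrow> 'm"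
    and \<chi>1 \<chi>2 :: "'w \<Rightarrow> 'a \<Rightarrow> 'm"
  assumes "nijenhuis_family_algebra A"
    and "nijenhuis_family_bimodule A M"
  shows
    "((\<psi>1, \<chi>1) \<in> Z2_NFA (partial1 A M) A M \<and>
      (\<psi>2, \<chi>2) \<in> Z2_NFA (partial1 A M) A M \<and>
      H2_class (partial1 A M) A M (\<psi>1, \<chi>1) = H2_class (partial1 A M) A M (\<psi>2, \<chi>2)
      \<longrightarrow>
      isomorphic_extensions
        (ext_nfa A M \<psi>1 \<chi>1) ext_inj ext_proj (ext_nfa A M \<psi>2 \<chi>2) ext_inj ext_proj) \<and>
     ((\<psi>1, \<chi>1) \<in> Z2_NFA (partial1_corrected A M) A M \<and>
      (\<psi>2, \<chi>2) \<in> Z2_NFA (partial1_corrected A M) A M \<and>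
      H2_class (partial1_corrected A M) A M (\<psi>1, \<chi>1) =
        H2_class (partial1_corrected A M) A M (\<psi>2, \<chi>2)
      \<longrightarrow>
      abelian_extension A M (ext_nfa A M \<psi>1 \<chi>1) ext_inj ext_proj \<and>
      abelian_extension A M (ext_nfa A M \<psi>2 \<chi>2) ext_inj ext_proj \<and>
      isomorphic_extensions
        (ext_nfa A M \<psi>1 \<chi>1) ext_inj ext_proj (ext_nfa A M \<psi>2 \<chi>2) ext_inj ext_proj)"
proof -
  interpret nijenhuis_bimodule A M
    using assms by unfold_locales
  show ?thesis
    using isomorphic_extensions_H2 abelian_extension_corrected by blast
qed

end
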